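(* Let $m,n\ge1$, $\lambda\in\mathbb{C}$, $\gamma>0$, and $J_n=\lambda I_n+\mathcal{N}^n$, where $\mathcal{N}^n$ is the $n\times n$ nilpotent matrix with entries $1$ at positions $(i,i+1)$, $i=1,\dots,n-1$, and $0$ elsewhere. Let the communication graph switch with a positive dwell time: there are instants $0=t_0<t_1<t_2<\cdots$ and $\underline{h}>0$ with $t_{k+1}-t_k\ge\underline{h}$ for all $k$, such that the weights $\alpha_{ij}(t)\ge0$ are constant on each interval $[t_k,t_{k+1})$. Then the multi-agent system $$\dot{x}_i(t)=J_n x_i(t)+\gamma I_n\sum_{j=1}^m\alpha_{ij}(t)\,(x_j(t)-x_i(t)),\qquad i=1,\dots,m,$$ reaches consensus if the multi-agent system $$\dot{x}_i(t)=\lambda I_n x_i(t)+\gamma I_n\sum_{j=1}^m\alpha_{ij}(t)\,(x_j(t)-x_i(t)),\qquad i=1,\dots,m,$$ (with the same $\gamma$ and the same $\alpha_{ij}(t)$) reaches consensus exponentially for all initial conditions $x_i(0)$, $i=1,\dots,m$.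
   Context: The states are $x_i(t)\in\mathbb{C}^n$. A system reaches consensus if for all initial conditions $\|x_i(t)-x_j(t)\|\to0$ as $t\to\infty$ for all $i,j$. It reaches consensus exponentially if there are $c,\mu>0$ such that for all initial conditions $\|x_i(t)-x_j(t)\|\le c\,e^{-\mu t}\max_k\|x_k(0)\|$ for all $t\ge0$ and all $i,j$. *)

theory Defs
  imports "HOL-Analysis.Analysis"
begin

text \<open>
  Coordinates of the agents' states are indexed by a finite linearly ordered type. The position
  of an index \<open>i\<close> in the resulting numbering \<open>1, \<dots>, n\<close> is \<open>card {..i}\<close>.
\<close>

definition superdiag :: "complex ^ 'n::{finite,linorder} ^ 'n::{finite,linorder}" where
  "superdiag = (\<chi> i j. if card {..j} = card {..i} + 1 then 1 else 0)"

text \<open>The constant \<open>mat l\<close> is the scalar matrix with \<open>l\<close> on the diagonal.\<close>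

definition jordan_matrix :: "complex \<Rightarrow> complex ^ 'n::{finite,linorder} ^ 'n::{finite,linorder}" where
  "jordan_matrix l = mat l + superdiag"

text \<open>
  The trajectories on \<open>[0,\<infinity>)\<close> of
  \<open>x\<^sub>i' = A x\<^sub>i + B (\<Sum>j. \<alpha> i j t (x\<^sub>j - x\<^sub>i))\<close>
  with switching instants \<open>\<tau> 0 < \<tau> 1 < \<dots>\<close>. The weights may jump at these instants, so a
  trajectory is required to be continuous and to satisfy the equation on each
  \<open>[\<tau> k, \<tau> (k+1))\<close>, the derivative being the right-hand one at \<open>\<tau> k\<close>. Values
  at negative times are irrelevant. Every initial condition \<open>x i 0\<close> is allowed.
\<close>

definition mas_trajectories ::
  "(nat \<Rightarrow> real) \<Rightarrow> complex ^ 'n ^ 'n \<Rightarrow> complex ^ 'n ^ 'n \<Rightarrow> ('m \<Rightarrow> 'm \<Rightarrow> real \<Rightarrow> real) \<Rightarrow>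
    ('m::finite \<Rightarrow> real \<Rightarrow> complex ^ 'n::finite) set" where
  "mas_trajectories \<tau> A B \<alpha> = {x. \<forall>i.
     continuous_on {0..} (x i) \<and>
     (\<forall>k. \<forall>t\<in>{\<tau> k..<\<tau> (Suc k)}.
        (x i has_vector_derivative
           A *v x i t + B *v (\<Sum>j\<in>UNIV. \<alpha> i j t *\<^sub>R (x j t - x i t)))
          (at t within {\<tau> k..<\<tau> (Suc k)}))}"

definition reaches_consensus :: "('m::finite \<Rightarrow> real \<Rightarrow> complex ^ 'n::finite) set \<Rightarrow> bool" where
  "reaches_consensus X \<longleftrightarrow>
     (\<forall>x\<in>X. \<forall>i j. ((\<lambda>t. norm (x i t - x j t)) \<longlongrightarrow> 0) at_top)"

definition reaches_consensus_exponentially ::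
  "('m::finite \<Rightarrow> real \<Rightarrow> complex ^ 'n::finite) set \<Rightarrow> bool" where
  "reaches_consensus_exponentially X \<longleftrightarrow>
     (\<exists>c>0. \<exists>\<mu>>0. \<forall>x\<in>X. \<forall>t\<ge>0. \<forall>i j.
        norm (x i t - x j t) \<le> c * exp (- \<mu> * t) * Max (range (\<lambda>k. norm (x k 0))))"

end

theory Submission
  imports Defs "HOL-Real_Asymp.Real_Asymp"
begin

text \<open>
  The nilpotent part \<open>N\<close> of the Jordan block commutes with the scalar matrices \<open>l I\<close> and
  \<open>\<gamma> I\<close>, so \<open>y\<^sub>i(t) = exp(-t N) x\<^sub>i(t)\<close> turns a trajectory \<open>x\<close> of the Jordan system
  into a trajectory \<open>y\<close> of the scalar one. Conversely \<open>x\<^sub>i - x\<^sub>j = exp(t N) (y\<^sub>i - y\<^sub>j)\<close>, and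
  the polynomial growth of \<open>exp(t N)\<close> is beaten by the exponential decay of \<open>y\<^sub>i - y\<^sub>j\<close>.
\<close>

text \<open>This is \<open>exp(t L)\<close> when \<open>L ^^ M = 0\<close>.\<close>

definition nilpotent_exp :: "('a \<Rightarrow> 'a) \<Rightarrow> nat \<Rightarrow> real \<Rightarrow> 'a::real_vector \<Rightarrow> 'a" where
  "nilpotent_exp L M t v = (\<Sum>k\<le>M. (t ^ k / fact k) *\<^sub>R (L ^^ k) v)"

lemma bounded_linear_funpow:
  fixes L :: "'a::real_normed_vector \<Rightarrow> 'a"
  assumes "bounded_linear L"
  shows "bounded_linear (L ^^ k)"
proof (induction k)
  case 0
  then show ?case by (simp add: id_def)
next
  case (Suc k)
  then show ?case
    using bounded_linear_compose[OF assms Suc] by (simp add: o_def)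
qed

lemma bounded_linear_nilpotent_exp:
  fixes L :: "'a::real_normed_vector \<Rightarrow> 'a"
  assumes "bounded_linear L"
  shows "bounded_linear (nilpotent_exp L M t)"
  unfolding nilpotent_exp_def
  by (intro bounded_linear_sum bounded_linear_scaleR_right[THEN bounded_linear_compose]
      bounded_linear_funpow assms)

text \<open>\<open>A\<close> commutes with every power of \<open>L\<close>, hence with a polynomial
  in \<open>L\<close>. This serves both for the system matrices and for \<open>A = L\<close>
  itself.\<close>

lemma nilpotent_exp_commute:
  assumes "linear A" and commute: "\<And>v. A (L v) = L (A v)"
  shows "A (nilpotent_exp L M t v) = nilpotent_exp L M t (A v)"
proof -
  have "A ((L ^^ k) v) = (L ^^ k) (A v)" for k
    by (induction k) (simp_all add: commute)
  then show ?thesis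
    by (simp add: nilpotent_exp_def linear_sum[OF assms(1)] linear_cmul[OF assms(1)])
qed

text \<open>Product rule, term by term. Nilpotency makes the truncated series satisfy E' = L E
  exactly, with no remainder term. The factor \<open>c\<close> covers both time directions,
  \<open>1\<close> and \<open>- 1\<close>.\<close>

lemma has_vector_derivative_nilpotent_exp:
  fixes L :: "'a::real_normed_vector \<Rightarrow> 'a"
  assumes L: "bounded_linear L" and nil: "\<And>v. (L ^^ M) v = 0"
    and x: "(x has_vector_derivative x') (at t within S)"
  shows "((\<lambda>s. nilpotent_exp L M (c * s) (x s)) has_vector_derivative
           nilpotent_exp L M (c * t) x' + c *\<^sub>R L (nilpotent_exp L M (c * t) (x t))) (at t within S)"
proof -
  have lin: "linear L"
    using L bounded_linear.linear by blast
  \<comment> \<open>At \<open>k = 0\<close> the exponent \<open>k - 1\<close> is truncated to 0, but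
    the factor \<open>real k\<close> removes the term.\<close>
  have "((\<lambda>s. ((c * s) ^ k / fact k) *\<^sub>R (L ^^ k) (x s)) has_vector_derivative
      ((c * t) ^ k / fact k) *\<^sub>R (L ^^ k) x' +
      (real k * c * (c * t) ^ (k - 1) / fact k) *\<^sub>R (L ^^ k) (x t)) (at t within S)" for k
    by (intro has_vector_derivative_scaleR bounded_linear.has_vector_derivative[OF _ x]
        bounded_linear_funpow L) (auto intro!: derivative_eq_intros)
  then have "((\<lambda>s. nilpotent_exp L M (c * s) (x s)) has_vector_derivative
      (\<Sum>k\<le>M. ((c * t) ^ k / fact k) *\<^sub>R (L ^^ k) x' +
        (real k * c * (c * t) ^ (k - 1) / fact k) *\<^sub>R (L ^^ k) (x t))) (at t within S)"
    unfolding nilpotent_exp_def by (intro has_vector_derivative_sum)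
  moreover have "(\<Sum>k\<le>M. (real k * c * (c * t) ^ (k - 1) / fact k) *\<^sub>R (L ^^ k) (x t)) =
      c *\<^sub>R L (nilpotent_exp L M (c * t) (x t))"
  proof (cases M)
    \<comment> \<open>Here \<open>nil\<close> says that every vector is 0, so both sides
      vanish.\<close>
    case 0
    then show ?thesis
      using nil linear_0[OF lin] by (simp add: nilpotent_exp_def)
  next
    case (Suc K)
    have shift: "real (Suc k) * c * (c * t) ^ k / fact (Suc k) = c * ((c * t) ^ k / fact k)" for k
      by (simp add: field_simps del: of_nat_Suc)
    have "(\<Sum>k\<le>Suc K. (real k * c * (c * t) ^ (k - 1) / fact k) *\<^sub>R (L ^^ k) (x t)) =
        (\<Sum>k\<le>K. (c * ((c * t) ^ k / fact k)) *\<^sub>R (L ^^ Suc k) (x t))"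
      by (subst sum.atMost_Suc_shift) (simp only: shift diff_Suc_1 of_nat_0 mult_zero_left div_0 scaleR_zero_left add_0)
    also have "\<dots> = c *\<^sub>R L (\<Sum>k\<le>K. ((c * t) ^ k / fact k) *\<^sub>R (L ^^ k) (x t))"
      by (simp add: linear_sum[OF lin] linear_cmul[OF lin] scaleR_sum_right)
    \<comment> \<open>The index shift has lost only the top term \<open>k = M\<close>, and that term
      is zero by \<open>nil\<close>.\<close>
    also have "(\<Sum>k\<le>K. ((c * t) ^ k / fact k) *\<^sub>R (L ^^ k) (x t)) =
        nilpotent_exp L M (c * t) (x t)"
      using nil[of "x t"] Suc by (simp add: nilpotent_exp_def)
    finally show ?thesis
      using Suc by simp
  qed
  ultimately show ?thesis
    by (simp add: nilpotent_exp_def sum.distrib)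
qed

lemma nilpotent_exp_0: "nilpotent_exp L M 0 v = v"
  unfolding nilpotent_exp_def by (subst sum.atMost_shift) simp

text \<open>Instead of multiplying out the two sums, differentiate \<open>?E s (?E (- s) v)\<close>
  in \<open>s\<close>: the derivative vanishes, so the value is the one at \<open>s = 0\<close>,
  which is \<open>v\<close>.\<close>

lemma nilpotent_exp_minus_cancel:
  fixes L :: "'a::real_normed_vector \<Rightarrow> 'a"
  assumes L: "bounded_linear L" and nil: "\<And>v. (L ^^ M) v = 0"
  shows "nilpotent_exp L M t (nilpotent_exp L M (- t) v) = v"
proof -
  let ?E = "nilpotent_exp L M"
  have E: "linear (?E s)" for s
    using bounded_linear.linear[OF bounded_linear_nilpotent_exp[OF L]] .
  have "((\<lambda>s. ?E s (?E (- s) v)) has_vector_derivative 0) (at s within UNIV)" for s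
  proof -
    \<comment> \<open>The inner factor is the derivative rule with \<open>c = - 1\<close> and the
      constant function \<open>v\<close>; the outer one below takes \<open>c = 1\<close>.\<close>
    have "((\<lambda>s. ?E (- 1 * s) v) has_vector_derivative
        ?E (- 1 * s) 0 + (- 1) *\<^sub>R L (?E (- 1 * s) v)) (at s within UNIV)"
      by (intro has_vector_derivative_nilpotent_exp[OF L nil]) simp
    then have "((\<lambda>s. ?E (- s) v) has_vector_derivative - L (?E (- s) v)) (at s within UNIV)"
      by (simp add: linear_0[OF E])
    from has_vector_derivative_nilpotent_exp[OF L nil this, of 1]
    have "((\<lambda>s. ?E s (?E (- s) v)) has_vector_derivative
        ?E s (- L (?E (- s) v)) + L (?E s (?E (- s) v))) (at s within UNIV)"
      by simp
    moreover have "?E s (- L (?E (- s) v)) = - L (?E s (?E (- s) v))"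
      using nilpotent_exp_commute[OF bounded_linear.linear[OF L], of L M s "?E (- s) v"]
      by (simp add: linear_neg[OF E])
    ultimately show ?thesis
      by simp
  qed
  then obtain w where "\<And>s. ?E s (?E (- s) v) = w"
    using has_vector_derivative_zero_constant[OF convex_UNIV] by (metis UNIV_I)
  then show ?thesis
    by (metis nilpotent_exp_0 minus_zero)
qed

text \<open>The sum is finite, and in each term the exponential decay of \<open>d\<close> beats the
  factor \<open>t ^ k\<close>.\<close>

lemma nilpotent_exp_tendsto_0:
  fixes L :: "'a::real_normed_vector \<Rightarrow> 'a"
  assumes L: "bounded_linear L" and "\<mu> > 0"
    and bound: "\<And>t. t \<ge> 0 \<Longrightarrow> norm (d t) \<le> C * exp (- \<mu> * t)"
  shows "((\<lambda>t. nilpotent_exp L M t (d t)) \<longlongrightarrow> 0) at_top"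
proof -
  have "((\<lambda>t. (t ^ k / fact k) *\<^sub>R (L ^^ k) (d t)) \<longlongrightarrow> 0) at_top" for k
  proof -
    interpret Lk: bounded_linear "L ^^ k"
      by (rule bounded_linear_funpow[OF L])
    have "((\<lambda>t. (t ^ k / fact k) * (C * exp (- \<mu> * t))) \<longlongrightarrow> 0) at_top"
      using \<open>\<mu> > 0\<close> by real_asymp
    moreover have "\<forall>\<^sub>F t in at_top. norm ((t ^ k / fact k) *\<^sub>R d t) \<le> (t ^ k / fact k) * (C * exp (- \<mu> * t))"
      using eventually_ge_at_top[of 0]
      by eventually_elim (use bound in \<open>auto intro!: divide_right_mono mult_left_mono\<close>)
    ultimately have "((\<lambda>t. (t ^ k / fact k) *\<^sub>R d t) \<longlongrightarrow> 0) at_top"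
      by (rule Lim_null_comparison[rotated])
    \<comment> \<open>The scalar weight was kept with \<open>d t\<close>, so the fixed bounded
      operator \<open>L ^^ k\<close> only has to preserve a limit at 0.\<close>
    from Lk.tendsto[OF this] show ?thesis
      by (simp add: Lk.scaleR)
  qed
  then show ?thesis
    unfolding nilpotent_exp_def by (intro tendsto_null_sum)
qed

text \<open>Vector derivatives refer to the real scalar action, so linearity over the reals is the
  form required.\<close>

lemma bounded_linear_matrix_vector_mult_complex:
  "bounded_linear ((*v) (A :: complex ^ 'n ^ 'm))"
proof -
  have "linear ((*v) A)"
  proof (rule linearI)
    show "A *v (r *\<^sub>R v) = r *\<^sub>R (A *v v)" for r v
      by (simp add: matrix_vector_mult_def vec_eq_iff scaleR_sum_right)
  qed (rule matrix_vector_right_distrib)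
  then show ?thesis
    by (rule linear_conv_bounded_linear[THEN iffD1])
qed

lemma mat_mult_commute:
  fixes A :: "complex ^ 'n ^ 'n"
  shows "mat c *v (A *v v) = A *v (mat c *v v)"
proof -
  have mat_mult: "mat c *v w = c *s w" for w :: "complex ^ 'n"
    by (simp add: matrix_vector_mult_def mat_def vec_eq_iff if_distrib[where f = "\<lambda>z. z * _"]
        cong: if_cong)
  show ?thesis
    by (simp add: mat_mult vector_scalar_commute)
qed

text \<open>Each application moves the entry at position p + 1 to position p and puts 0 in the last
  position.\<close>

lemma superdiag_nilpotent:
  "(((*v) superdiag) ^^ CARD('n)) (v :: complex ^ 'n::{finite,linorder}) = 0"
proof -
  \<comment> \<open>Induction on \<open>k\<close> for all \<open>i\<close> at once: the only nonzero
    entry of row \<open>i\<close> is in the column one position further, where the induction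
    hypothesis applies. Positions start at 1, so \<open>k = CARD('n)\<close> reaches every
    \<open>i\<close>.\<close>
  have "((((*v) superdiag) ^^ k) v) $ i = 0" if "card {..i} + k > CARD('n)" for k i
    using that
  proof (induction k arbitrary: i)
    case 0
    then show ?case
      using card_mono[OF finite[of UNIV] subset_UNIV, of "{..i}"] by simp
  next
    case (Suc k)
    then show ?case
      by (auto simp: matrix_vector_mult_def superdiag_def intro!: sum.neutral)
  qed
  moreover have "card {..i} > 0" for i :: 'n
    by (auto simp: card_gt_0_iff)
  ultimately show ?thesis
    by (simp add: vec_eq_iff)
qed

text \<open>Differentiating the factor \<open>?E (- t)\<close> contributes \<open>- N\<close>, which
  cancels the \<open>N\<close> in \<open>A + N\<close>. Commutation lets \<open>?E (- t)\<close>
  pass through \<open>A\<close> and \<open>B\<close>.\<close>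

lemma nilpotent_exp_mas_trajectory:
  fixes A B N :: "complex ^ 'n ^ 'n"
  assumes nil: "\<And>v. (((*v) N) ^^ M) v = 0"
    and A: "\<And>v. A *v (N *v v) = N *v (A *v v)"
    and B: "\<And>v. B *v (N *v v) = N *v (B *v v)"
    and x: "x \<in> mas_trajectories \<tau> (A + N) B \<alpha>"
  shows "(\<lambda>i t. nilpotent_exp ((*v) N) M (- t) (x i t)) \<in> mas_trajectories \<tau> A B \<alpha>"
proof -
  let ?E = "nilpotent_exp ((*v) N) M"
  note blin = bounded_linear_matrix_vector_mult_complex
  note lin = bounded_linear.linear[OF blin]
  have E: "linear (?E s)" for s
    by (rule bounded_linear.linear[OF bounded_linear_nilpotent_exp[OF blin]])
  have "continuous_on {0..} (\<lambda>t. ?E (- t) (x i t))" for i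
  proof -
    have "continuous_on {0..} (x i)"
      using x by (simp add: mas_trajectories_def)
    then show ?thesis
      unfolding nilpotent_exp_def
      by (intro continuous_intros bounded_linear.continuous_on[OF bounded_linear_funpow[OF blin]]) simp
  qed
  moreover have "((\<lambda>t. ?E (- t) (x i t)) has_vector_derivative
      A *v ?E (- t) (x i t) + B *v (\<Sum>j\<in>UNIV. \<alpha> i j t *\<^sub>R (?E (- t) (x j t) - ?E (- t) (x i t))))
      (at t within {\<tau> k..<\<tau> (Suc k)})" if t: "t \<in> {\<tau> k..<\<tau> (Suc k)}" for i k t
  proof -
    let ?s = "\<Sum>j\<in>UNIV. \<alpha> i j t *\<^sub>R (x j t - x i t)"
    have "(x i has_vector_derivative (A + N) *v x i t + B *v ?s) (at t within {\<tau> k..<\<tau> (Suc k)})"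
      using x t by (simp add: mas_trajectories_def)
    from has_vector_derivative_nilpotent_exp[OF blin nil this, of "- 1"]
    have "((\<lambda>t. ?E (- t) (x i t)) has_vector_derivative
        ?E (- t) ((A + N) *v x i t + B *v ?s) - N *v ?E (- t) (x i t))
        (at t within {\<tau> k..<\<tau> (Suc k)})"
      by simp
    moreover have "?E (- t) ((A + N) *v x i t + B *v ?s) =
        A *v ?E (- t) (x i t) + N *v ?E (- t) (x i t) + B *v ?E (- t) ?s"
      by (simp add: matrix_vector_mult_add_rdistrib linear_add[OF E]
          nilpotent_exp_commute[OF lin, of _ "(*v) N"] A B)
    \<comment> \<open>The same operator is applied to all agents, so by linearity the coupling keeps
      its form and its weights.\<close>
    moreover have "?E (- t) ?s = (\<Sum>j\<in>UNIV. \<alpha> i j t *\<^sub>R (?E (- t) (x j t) - ?E (- t) (x i t)))"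
      by (simp add: linear_sum[OF E] linear_cmul[OF E] linear_diff[OF E])
    ultimately show ?thesis
      by simp
  qed
  ultimately show ?thesis
    by (simp add: mas_trajectories_def)
qed

theorem lemma1:
  fixes l :: complex and \<gamma> h :: real
    and \<tau> :: "nat \<Rightarrow> real"
    and \<alpha> :: "'m::finite \<Rightarrow> 'm \<Rightarrow> real \<Rightarrow> real"
  assumes "\<gamma> > 0"
    and "\<tau> 0 = 0"
    and "\<And>k. \<tau> k < \<tau> (Suc k)"
    and "h > 0"
    and "\<And>k. \<tau> (Suc k) - \<tau> k \<ge> h"
    and "\<And>i j t. t \<ge> 0 \<Longrightarrow> \<alpha> i j t \<ge> 0"
    and "\<And>i j k t. t \<in> {\<tau> k..<\<tau> (Suc k)} \<Longrightarrow> \<alpha> i j t = \<alpha> i j (\<tau> k)"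
    and "reaches_consensus_exponentially
           (mas_trajectories \<tau> (mat l) (mat (complex_of_real \<gamma>)) \<alpha> ::
              ('m \<Rightarrow> real \<Rightarrow> complex ^ 'n::{finite,linorder}) set)"
  shows "reaches_consensus
           (mas_trajectories \<tau> (jordan_matrix l) (mat (complex_of_real \<gamma>)) \<alpha> ::
              ('m \<Rightarrow> real \<Rightarrow> complex ^ 'n::{finite,linorder}) set)"
  unfolding reaches_consensus_def
proof (intro ballI allI)
  let ?N = "superdiag :: complex ^ 'n::{finite,linorder} ^ 'n::{finite,linorder}"
  let ?E = "nilpotent_exp ((*v) ?N) CARD('n)"
  fix x :: "'m \<Rightarrow> real \<Rightarrow> complex ^ 'n::{finite,linorder}" and i j
  assume x: "x \<in> mas_trajectories \<tau> (jordan_matrix l) (mat (complex_of_real \<gamma>)) \<alpha>"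
  define y where "y = (\<lambda>i t. ?E (- t) (x i t))"
  note blin = bounded_linear_matrix_vector_mult_complex
  have y: "y \<in> mas_trajectories \<tau> (mat l) (mat (complex_of_real \<gamma>)) \<alpha>"
    unfolding y_def
    by (intro nilpotent_exp_mas_trajectory superdiag_nilpotent mat_mult_commute
        x[unfolded jordan_matrix_def])
  obtain c \<mu> where "\<mu> > 0" and bound: "\<And>t. t \<ge> 0 \<Longrightarrow>
      norm (y i t - y j t) \<le> c * exp (- \<mu> * t) * Max (range (\<lambda>k. norm (y k 0)))"
    using assms(8) y unfolding reaches_consensus_exponentially_def by blast
  have "((\<lambda>t. ?E t (y i t - y j t)) \<longlongrightarrow> 0) at_top"
  \<comment> \<open>The maximum of the initial norms does not depend on \<open>t\<close> and joins
    \<open>c\<close> in the constant \<open>C\<close>.\<close>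
  proof (rule nilpotent_exp_tendsto_0[OF blin \<open>\<mu> > 0\<close>])
    show "norm (y i t - y j t) \<le> c * Max (range (\<lambda>k. norm (y k 0))) * exp (- \<mu> * t)"
      if "t \<ge> 0" for t
      using bound[OF that] by (simp add: mult_ac)
  qed
  \<comment> \<open>Linearity splits the difference, and \<open>?E t\<close> undoes
    \<open>?E (- t)\<close> for each agent.\<close>
  moreover have "?E t (y i t - y j t) = x i t - x j t" for t
    unfolding y_def
    by (simp add: linear_diff[OF bounded_linear.linear[OF bounded_linear_nilpotent_exp[OF blin]]]
        nilpotent_exp_minus_cancel[OF blin superdiag_nilpotent])
  ultimately show "((\<lambda>t. norm (x i t - x j t)) \<longlongrightarrow> 0) at_top"
    by (simp add: tendsto_norm_zero)
qed

end
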